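(* Let $(E,\pi,B)$ be a real vector bundle with $n$-dimensional fibres and let $g$ be a real bundle metric on it. A necessary and sufficient condition for the existence of a linear transport along paths globally consistent with $g$ (resp. locally consistent with $g$, i.e. consistent with $g$ along a given path $\gamma:J\to B$) is the independence of the signature of the bundle metric, i.e. of the matrix $G(x)$, from the point at which it is evaluated, i.e. from $x\in B$ (resp. from $x\in\gamma(J)$).
   Context: Paths in $B$ are denoted $\gamma:J\to B$, with $J$ an arbitrary real interval. A real bundle metric $g$ assigns to each $x\in B$ a bilinear, symmetric, nondegenerate map $g_x:\pi^{-1}(x)\times\pi^{-1}(x)\to\mathbb{R}$. A linear transport along paths $L$ assigns to each path $\gamma:J\to B$ and $s,t\in J$ a linear map $L^\gamma_{s\to t}:\pi^{-1}(\gamma(s))\to\pi^{-1}(\gamma(t))$ with $L^\gamma_{t\to r}\circ L^\gamma_{s\to t}=L^\gamma_{s\to r}$ and $L^\gamma_{s\to s}=\mathrm{id}$ for all $r,s,t\in J$. $L$ and $g$ are consistent along $\gamma$ (locally consistent) if $g_{\gamma(s)}(u,v)=g_{\gamma(t)}(L^\gamma_{s\to t}u,L^\gamma_{s\to t}v)$ for all $s,t\in J$ and $u,v\in\pi^{-1}(\gamma(s))$; they are (globally) consistent if this holds along every path. $G(x)=[g_x(e_i,e_j)]$ for a basis $\{e_i\}$ of $\pi^{-1}(x)$; its signature is $p(x)-q(x)$, where $p(x)$ and $q(x)$ are the numbers of positive and negative eigenvalues of $G(x)$. Since $p(x)+q(x)=n$, constancy of the signature is equivalent to constancy of $p(x)$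 and/or of $q(x)$. *)

theory Defs
  imports "HOL-Analysis.Analysis" "Jordan_Normal_Form.VS_Connect" "Jordan_Normal_Form.Char_Poly"
begin

text \<open>
  The total space is a topology on a type \<open>'e\<close>. The vector space structure of the fibre over
  \<open>x\<close> is the module record \<open>F x\<close> over the reals (\<open>class_ring\<close>); its carrier is the preimage of
  \<open>x\<close> under the projection. The ring operations \<open>mult\<close> and \<open>one\<close> of the record play no role.
\<close>

definition local_trivialization ::
  "nat \<Rightarrow> 'e topology \<Rightarrow> 'b topology \<Rightarrow> ('e \<Rightarrow> 'b) \<Rightarrow> ('b \<Rightarrow> (real, 'e) module) \<Rightarrow>
   'b set \<Rightarrow> ('e \<Rightarrow> 'b \<times> (nat \<Rightarrow> real)) \<Rightarrow> bool" where
  "local_trivialization n E B proj F U \<phi> \<longleftrightarrow>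
     openin B U \<and>
     homeomorphic_map (subtopology E {u \<in> topspace E. proj u \<in> U})
       (prod_topology (subtopology B U) (Euclidean_space n)) \<phi> \<and>
     (\<forall>u \<in> topspace E. proj u \<in> U \<longrightarrow> fst (\<phi> u) = proj u) \<and>
     (\<forall>x \<in> U.
        (\<forall>u \<in> carrier (F x). \<forall>v \<in> carrier (F x). \<forall>i.
           snd (\<phi> (u \<oplus>\<^bsub>F x\<^esub> v)) i = snd (\<phi> u) i + snd (\<phi> v) i) \<and>
        (\<forall>c. \<forall>u \<in> carrier (F x). \<forall>i. snd (\<phi> (c \<odot>\<^bsub>F x\<^esub> u)) i = c * snd (\<phi> u) i))"

definition real_vector_bundle ::
  "nat \<Rightarrow> 'e topology \<Rightarrow> 'b topology \<Rightarrow> ('e \<Rightarrow> 'b) \<Rightarrow> ('b \<Rightarrow> (real, 'e) module) \<Rightarrow> bool" where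
  "real_vector_bundle n E B proj F \<longleftrightarrow>
     continuous_map E B proj \<and>
     (\<forall>x \<in> topspace B.
        carrier (F x) = {u \<in> topspace E. proj u = x} \<and>
        vectorspace class_ring (F x) \<and>
        vectorspace.fin_dim class_ring (F x) \<and> vectorspace.dim class_ring (F x) = n) \<and>
     (\<forall>x \<in> topspace B. \<exists>U \<phi>. x \<in> U \<and> local_trivialization n E B proj F U \<phi>)"

text \<open>No continuity of \<open>g\<close> in the base point is required.\<close>

definition bundle_metric ::
  "'b topology \<Rightarrow> ('b \<Rightarrow> (real, 'e) module) \<Rightarrow> ('b \<Rightarrow> 'e \<Rightarrow> 'e \<Rightarrow> real) \<Rightarrow> bool" where
  "bundle_metric B F g \<longleftrightarrow>
     (\<forall>x \<in> topspace B.
        (\<forall>u \<in> carrier (F x). \<forall>v \<in> carrier (F x). \<forall>w \<in> carrier (F x).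
           g x (u \<oplus>\<^bsub>F x\<^esub> v) w = g x u w + g x v w \<and>
           g x w (u \<oplus>\<^bsub>F x\<^esub> v) = g x w u + g x w v) \<and>
        (\<forall>c. \<forall>u \<in> carrier (F x). \<forall>v \<in> carrier (F x).
           g x (c \<odot>\<^bsub>F x\<^esub> u) v = c * g x u v \<and> g x u (c \<odot>\<^bsub>F x\<^esub> v) = c * g x u v) \<and>
        (\<forall>u \<in> carrier (F x). \<forall>v \<in> carrier (F x). g x u v = g x v u) \<and>
        (\<forall>u \<in> carrier (F x). (\<forall>v \<in> carrier (F x). g x u v = 0) \<longrightarrow> u = \<zero>\<^bsub>F x\<^esub>))"

text \<open>
  A path is a map from a real interval \<open>J\<close> to the base, represented by the pair of \<open>J\<close> and a
  function that is \<open>undefined\<close> outside \<open>J\<close>, so that distinct pairs are distinct maps.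
  Two classes of paths are considered: arbitrary maps and continuous maps. Continuous paths do not
  compare the fibres over different path components, so with them a global statement about all of
  the base needs a path-connected base; with arbitrary maps it does not.
\<close>

definition all_paths :: "'b topology \<Rightarrow> (real set \<times> (real \<Rightarrow> 'b)) set" where
  "all_paths B = {(J, \<gamma>). is_interval J \<and> \<gamma> \<in> J \<rightarrow>\<^sub>E topspace B}"

definition continuous_paths :: "'b topology \<Rightarrow> (real set \<times> (real \<Rightarrow> 'b)) set" where
  "continuous_paths B = {(J, \<gamma>) \<in> all_paths B. continuous_map (top_of_set J) B \<gamma>}"

text \<open>\<open>L J \<gamma> s t\<close> is the transport from \<open>s\<close> to \<open>t\<close> along \<open>\<gamma> : J \<rightarrow> B\<close>.\<close>

type_synonym ('b, 'e) transport = "real set \<Rightarrow> (real \<Rightarrow> 'b) \<Rightarrow> real \<Rightarrow> real \<Rightarrow> 'e \<Rightarrow> 'e"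

definition linear_transport ::
  "(real set \<times> (real \<Rightarrow> 'b)) set \<Rightarrow> ('b \<Rightarrow> (real, 'e) module) \<Rightarrow> ('b, 'e) transport \<Rightarrow> bool" where
  "linear_transport P F L \<longleftrightarrow>
     (\<forall>(J, \<gamma>) \<in> P.
        (\<forall>s \<in> J. \<forall>t \<in> J.
           L J \<gamma> s t \<in> LinearCombinations.module_hom class_ring (F (\<gamma> s)) (F (\<gamma> t))) \<and>
        (\<forall>r \<in> J. \<forall>s \<in> J. \<forall>t \<in> J. \<forall>u \<in> carrier (F (\<gamma> s)).
           L J \<gamma> t r (L J \<gamma> s t u) = L J \<gamma> s r u) \<and>
        (\<forall>s \<in> J. \<forall>u \<in> carrier (F (\<gamma> s)). L J \<gamma> s s u = u))"

definition consistent_along ::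
  "('b \<Rightarrow> (real, 'e) module) \<Rightarrow> ('b \<Rightarrow> 'e \<Rightarrow> 'e \<Rightarrow> real) \<Rightarrow> ('b, 'e) transport \<Rightarrow>
   real set \<Rightarrow> (real \<Rightarrow> 'b) \<Rightarrow> bool" where
  "consistent_along F g L J \<gamma> \<longleftrightarrow>
     (\<forall>s \<in> J. \<forall>t \<in> J. \<forall>u \<in> carrier (F (\<gamma> s)). \<forall>v \<in> carrier (F (\<gamma> s)).
        g (\<gamma> s) u v = g (\<gamma> t) (L J \<gamma> s t u) (L J \<gamma> s t v))"

definition globally_consistent ::
  "(real set \<times> (real \<Rightarrow> 'b)) set \<Rightarrow> ('b \<Rightarrow> (real, 'e) module) \<Rightarrow>
   ('b \<Rightarrow> 'e \<Rightarrow> 'e \<Rightarrow> real) \<Rightarrow> ('b, 'e) transport \<Rightarrow> bool" where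
  "globally_consistent P F g L \<longleftrightarrow> (\<forall>(J, \<gamma>) \<in> P. consistent_along F g L J \<gamma>)"

definition ordered_basis :: "(real, 'e) module \<Rightarrow> 'e list \<Rightarrow> bool" where
  "ordered_basis V es \<longleftrightarrow> distinct es \<and> vectorspace.basis class_ring V (set es)"

definition gram_matrix :: "('e \<Rightarrow> 'e \<Rightarrow> real) \<Rightarrow> 'e list \<Rightarrow> real mat" where
  "gram_matrix h es = mat (length es) (length es) (\<lambda>(i, j). h (es ! i) (es ! j))"

text \<open>Eigenvalues are counted with (algebraic) multiplicity.\<close>

definition num_pos_eigenvalues :: "real mat \<Rightarrow> nat" where
  "num_pos_eigenvalues A = (\<Sum>k | eigenvalue A k \<and> 0 < k. Polynomial.order k (char_poly A))"

definition num_neg_eigenvalues :: "real mat \<Rightarrow> nat" where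
  "num_neg_eigenvalues A = (\<Sum>k | eigenvalue A k \<and> k < 0. Polynomial.order k (char_poly A))"

definition signature :: "real mat \<Rightarrow> int" where
  "signature A = int (num_pos_eigenvalues A) - int (num_neg_eigenvalues A)"

text \<open>
  The basis of each fibre in which \<open>G(x)\<close> is formed is arbitrary, so the common value is required
  for every choice of basis at every point of \<open>S\<close>.
\<close>

definition constant_signature_on ::
  "'b set \<Rightarrow> ('b \<Rightarrow> (real, 'e) module) \<Rightarrow> ('b \<Rightarrow> 'e \<Rightarrow> 'e \<Rightarrow> real) \<Rightarrow> bool" where
  "constant_signature_on S F g \<longleftrightarrow>
     (\<exists>\<sigma>. \<forall>x \<in> S. \<forall>es. ordered_basis (F x) es \<longrightarrow> signature (gram_matrix (g x) es) = \<sigma>)"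

end

theory Submission
  imports Defs
begin


text \<open>
  Choose in every fibre a linear isomorphism from the coordinate space that turns the metric into
  \<open>diag(1, \<dots>, 1, -1, \<dots>, -1)\<close> with \<open>p(x)\<close> entries \<open>1\<close>; it comes from diagonalizing one Gram matrix
  orthogonally and rescaling. By Sylvester's law of inertia the signature of the Gram matrix is
  \<open>2 p(x) - n\<close> in every basis of the fibre. Mapping the frame at one point to the frame at the other
  is a linear transport, the same for all paths, and it is consistent with the metric wherever \<open>p\<close> is
  constant. Conversely, a consistent transport carries the normal form at one point of a path to a
  normal form at any other, so inertia gives equal \<open>p\<close>.
\<close>

section \<open>Real symmetric matrices\<close>

no_notation vec_nth (infixl \<open>$\<close> 90)
no_notation inner (infix \<open>\<bullet>\<close> 70)

text \<open>Over the complex numbers the characteristic polynomial splits. Symmetry makes every root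
  real, and injectivity of the embedding of real polynomials brings the factorization back to the
  reals.\<close>

lemma char_poly_symmetric_splits:
  fixes A :: "real mat"
  assumes A: "A \<in> carrier_mat n n" and sym: "transpose_mat A = A"
  obtains es where "char_poly A = (\<Prod>e\<leftarrow>es. [:- e, 1:])" and "length es = n"
proof -
  let ?A = "map_mat complex_of_real A"
  have cA: "?A \<in> carrier_mat n n" using A by simp
  obtain as where as: "char_poly ?A = (\<Prod>a\<leftarrow>as. [:- a, 1:])" and len: "length as = n"
    using char_poly_factorized[OF cA] by blast
  have real: "a \<in> \<real>" if a: "a \<in> set as" for a
  proof -
    have "poly (char_poly ?A) a = 0"
      unfolding as poly_prod_list using a by (auto simp: prod_list_zero_iff)
    then have "eigenvalue ?A a" using eigenvalue_root_char_poly[OF cA] by simp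
    then obtain v where v: "v \<in> carrier_vec n" "v \<noteq> 0\<^sub>v n" "?A *\<^sub>v v = a \<cdot>\<^sub>v v"
      unfolding eigenvalue_def eigenvector_def using A by auto
    \<comment> \<open>With \<open>v\<close> an eigenvector for \<open>a\<close>, \<open>S\<close> is
      the Hermitian form of \<open>A\<close> at \<open>v\<close> and \<open>N\<close> is the squared
      norm of \<open>v\<close>. \<open>S\<close> is computed in two ways: it equals
      \<open>a * N\<close>, and by symmetry of \<open>A\<close> it equals its own conjugate. As
      \<open>N\<close> is positive, \<open>a\<close> is real.\<close>
    define S where "S = (\<Sum>i<n. \<Sum>j<n. cnj (v $ i) * of_real (A $$ (i,j)) * v $ j)"
    define N where "N = (\<Sum>i<n. (cmod (v $ i))\<^sup>2)"
    have row: "(\<Sum>j<n. of_real (A $$ (i,j)) * v $ j) = a * v $ i" if "i < n" for i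
    proof -
      have "(?A *\<^sub>v v) $ i = (\<Sum>j<n. of_real (A $$ (i,j)) * v $ j)"
        using A v(1) that by (auto simp: scalar_prod_def atLeast0LessThan intro!: sum.cong)
      then show ?thesis using v that by simp
    qed
    have "S = (\<Sum>i<n. cnj (v $ i) * (\<Sum>j<n. of_real (A $$ (i,j)) * v $ j))"
      unfolding S_def by (simp add: sum_distrib_left mult.assoc)
    also have "\<dots> = (\<Sum>i<n. a * of_real ((cmod (v $ i))\<^sup>2))"
      by (intro sum.cong refl) (subst row, simp_all add: complex_norm_square[symmetric] mult_ac flip: of_real_power)
    finally have SN: "S = a * of_real N"
      unfolding N_def by (simp add: sum_distrib_left)
    have Asym: "A $$ (i,j) = A $$ (j,i)" if "i < n" "j < n" for i j
      using sym that A by (metis carrier_matD index_transpose_mat(1))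
    have "cnj S = (\<Sum>i<n. \<Sum>j<n. v $ i * of_real (A $$ (i,j)) * cnj (v $ j))"
      unfolding S_def by simp
    also have "\<dots> = (\<Sum>j<n. \<Sum>i<n. v $ i * of_real (A $$ (i,j)) * cnj (v $ j))"
      by (rule sum.swap)
    also have "\<dots> = S"
      unfolding S_def by (intro sum.cong refl) (auto simp: Asym)
    finally have "cnj S = S" .
    obtain i where i: "i < n" "v $ i \<noteq> 0"
      using v(1,2) by (metis carrier_vecD eq_vecI index_zero_vec)
    have "N > 0" unfolding N_def
      by (rule sum_pos2[where i = i]) (use i in auto)
    with SN \<open>cnj S = S\<close> have "cnj a = a" by auto
    then show ?thesis by (simp add: Reals_cnj_iff)
  qed
  interpret of_real_poly: map_poly_inj_idom_hom complex_of_real ..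
  have "map_poly complex_of_real (char_poly A) = char_poly ?A"
    by (simp add: of_real_hom.char_poly_hom[OF A])
  \<comment> \<open>Each root \<open>a\<close> equals \<open>of_real (Re a)\<close>, so every linear
    factor is the image of a real one.\<close>
  also have "\<dots> = (\<Prod>a\<leftarrow>as. map_poly of_real [:- Re a, 1:])"
    unfolding as by (intro arg_cong[where f = prod_list] map_cong refl)
      (use real in \<open>auto simp: of_real_Re\<close>)
  also have "\<dots> = map_poly complex_of_real (\<Prod>e\<leftarrow>map Re as. [:- e, 1:])"
    by (simp only: of_real_poly.hom_prod_list map_map o_def)
  finally have "char_poly A = (\<Prod>e\<leftarrow>map Re as. [:- e, 1:])"
    by (rule of_real_poly.injectivity)
  with len show ?thesis using that by (metis length_map)
qed

text \<open>The reflection in the hyperplane orthogonal to \<open>v\<close> minus the first unit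
  vector exchanges these two unit vectors. It is symmetric and its own inverse, so it replaces the
  completion of \<open>v\<close> to an orthonormal basis.\<close>

lemma householder_reflection:
  fixes v :: "real vec"
  assumes v: "v \<in> carrier_vec n" and unit: "v \<bullet> v = 1" and n: "0 < n"
  obtains H where "H \<in> carrier_mat n n" "transpose_mat H = H" "H * H = 1\<^sub>m n"
    "H *\<^sub>v unit_vec n 0 = v"
proof (cases "v = unit_vec n 0")
  case True
  then show ?thesis using that[of "1\<^sub>m n"] by simp
next
  case False
  define w where "w = (\<lambda>i. v $ i - (if i = 0 then 1 else 0 :: real))"
  define c where "c = (\<Sum>i<n. (w i)\<^sup>2)"
  obtain i where "i < n" "w i \<noteq> 0"
    using False v unfolding w_def
    by (fastforce intro!: eq_vecI simp: unit_vec_def split: if_splits)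
  then have c: "c > 0" unfolding c_def by (intro sum_pos2[where i = i]) auto
  have vv: "(\<Sum>i<n. (v $ i)\<^sup>2) = 1"
    using unit v by (simp add: scalar_prod_def power2_eq_square atLeast0LessThan)
  have "c = (\<Sum>i<n. (v $ i)\<^sup>2 + (if i = 0 then 1 - 2 * v $ 0 else 0))"
    unfolding c_def w_def by (intro sum.cong) (auto simp: power2_eq_square algebra_simps)
  also have "\<dots> = 2 - 2 * v $ 0"
    using n vv by (simp add: sum.distrib)
  \<comment> \<open>The squared length \<open>c\<close> of \<open>w\<close> is expressed through its
    first coordinate because \<open>v\<close> has length one. This is what turns the first column of
    \<open>H\<close> into the first unit vector plus \<open>w\<close>, that is,
    \<open>v\<close>.\<close>
  finally have c_eq: "c = - 2 * w 0" by (simp add: w_def)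
  \<comment> \<open>This is the identity minus 2/c times the outer product of \<open>w\<close> with
    itself. In its square the terms -4/c and (4/c^2) * c cancel.\<close>
  define H where "H = mat n n (\<lambda>(i,j). (if i = j then 1 else 0) - 2 / c * w i * w j)"
  have H: "H \<in> carrier_mat n n" by (simp add: H_def)
  have "(H * H) $$ (i,j) = (if i = j then 1 else 0)" if ij: "i < n" "j < n" for i j
  proof -
    have "(H * H) $$ (i,j) = (\<Sum>k<n. ((if i = k then 1 else 0) - 2 / c * w i * w k)
        * ((if k = j then 1 else 0) - 2 / c * w k * w j))"
      using ij by (simp add: H_def scalar_prod_def atLeast0LessThan)
    also have "\<dots> = (\<Sum>k<n. (if k = i then (if i = j then 1 else 0) - 2 / c * w i * w j else 0)
        - (if k = j then 2 / c * w i * w j else 0) + 4 / c\<^sup>2 * w i * w j * (w k)\<^sup>2)"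
      by (intro sum.cong) (auto simp: power2_eq_square algebra_simps)
    also have "\<dots> = (if i = j then 1 else 0) - 4 / c * w i * w j + 4 / c\<^sup>2 * w i * w j * c"
      using ij unfolding c_def sum_distrib_left by (simp add: sum.distrib sum_subtractf)
    also have "\<dots> = (if i = j then 1 else 0)"
      using c by (simp add: power2_eq_square)
    finally show ?thesis .
  qed
  then have "H * H = 1\<^sub>m n" using H by (intro eq_matI) auto
  moreover have "transpose_mat H = H"
    by (intro eq_matI) (auto simp: H_def)
  moreover have "H *\<^sub>v unit_vec n 0 = v"
  proof (rule eq_vecI)
    fix i assume "i < dim_vec v"
    then have i: "i < n" using v by simp
    have "(H *\<^sub>v unit_vec n 0) $ i = H $$ (i, 0)" using H i n by simp
    also have "\<dots> = (if i = 0 then 1 else 0) - 2 / c * w i * w 0" using i n by (simp add: H_def)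
    also have "\<dots> = (if i = 0 then 1 else 0) + w i" using c c_eq by (simp add: field_simps)
    also have "\<dots> = v $ i" by (simp add: w_def)
    finally show "(H *\<^sub>v unit_vec n 0) $ i = v $ i" .
  qed (use H v in auto)
  ultimately show ?thesis using that H by blast
qed

text \<open>Induction on the list of eigenvalues. A reflection moves a unit eigenvector for the
  first one to the first coordinate axis; symmetry then clears the rest of the first row and column,
  and the remaining block is symmetric with the remaining eigenvalues.\<close>

lemma symmetric_orthogonally_diagonalizable:
  fixes A :: "real mat"
  assumes "A \<in> carrier_mat n n" and "transpose_mat A = A"
    and "char_poly A = (\<Prod>e\<leftarrow>es. [:- e, 1:])" and "length es = n"
  shows "\<exists>U \<in> carrier_mat n n. transpose_mat U * U = 1\<^sub>m n \<and>
    transpose_mat U * A * U = mat_diag n (\<lambda>i. es ! i)"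
  using assms
proof (induction es arbitrary: n A)
  case Nil
  then show ?case by (intro bexI[of _ "1\<^sub>m 0"]) (auto simp: mat_diag_def)
next
  case (Cons e es)
  define m where "m = length es"
  have n: "n = Suc m" using Cons.prems by (simp add: m_def)
  note A = Cons.prems(1) and sym = Cons.prems(2)
  have "poly (char_poly A) e = 0" using Cons.prems(3) by simp
  then have "eigenvalue A e" using eigenvalue_root_char_poly[OF A] by simp
  then obtain u where u: "u \<in> carrier_vec n" "u \<noteq> 0\<^sub>v n" "A *\<^sub>v u = e \<cdot>\<^sub>v u"
    unfolding eigenvalue_def eigenvector_def using A by auto
  have pos: "u \<bullet> u > 0"
  proof -
    obtain i where "i < n" "u $ i \<noteq> 0"
      using u(1,2) by (metis carrier_vecD eq_vecI index_zero_vec)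
    then have "(\<Sum>i<n. (u $ i)\<^sup>2) > 0" by (intro sum_pos2[where i = i]) auto
    then show ?thesis
      using u(1) by (simp add: scalar_prod_def atLeast0LessThan power2_eq_square)
  qed
  define v where "v = (1 / sqrt (u \<bullet> u)) \<cdot>\<^sub>v u"
  have v: "v \<in> carrier_vec n" using u by (simp add: v_def)
  have "v \<bullet> v = 1" using u pos by (simp add: v_def)
  have Av: "A *\<^sub>v v = e \<cdot>\<^sub>v v"
    using u A by (simp add: v_def mult_mat_vec smult_smult_assoc mult.commute)
  obtain H where H: "H \<in> carrier_mat n n" and Ht: "transpose_mat H = H"
    and HH: "H * H = 1\<^sub>m n" and He: "H *\<^sub>v unit_vec n 0 = v"
    using householder_reflection[OF v \<open>v \<bullet> v = 1\<close>] n by auto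
  define A' where "A' = H * A * H"
  have A': "A' \<in> carrier_mat n n" using H A by (simp add: A'_def)
  have A't: "transpose_mat A' = A'"
  proof -
    have "transpose_mat A' = transpose_mat H * transpose_mat (H * A)"
      unfolding A'_def by (rule transpose_mult) (use H A in auto)
    also have "transpose_mat (H * A) = transpose_mat A * transpose_mat H"
      by (rule transpose_mult) (use H A in auto)
    finally show ?thesis
      unfolding A'_def Ht sym by (simp only: assoc_mult_mat[OF H A H])
  qed
  have e0: "unit_vec n 0 \<in> carrier_vec n" by simp
  have "A' *\<^sub>v unit_vec n 0 = H *\<^sub>v (A *\<^sub>v (H *\<^sub>v unit_vec n 0))"
    unfolding A'_def assoc_mult_mat_vec[OF mult_carrier_mat[OF H A] H e0]
      assoc_mult_mat_vec[OF H A mult_mat_vec_carrier[OF H e0]] ..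
  also have "\<dots> = e \<cdot>\<^sub>v (H *\<^sub>v v)" using He Av H v by (simp add: mult_mat_vec)
  also have "H *\<^sub>v v = (H * H) *\<^sub>v unit_vec n 0" unfolding assoc_mult_mat_vec[OF H H e0] He ..
  also have "\<dots> = unit_vec n 0" using HH by simp
  finally have A'e: "A' *\<^sub>v unit_vec n 0 = e \<cdot>\<^sub>v unit_vec n 0" .
  have col0: "A' $$ (i,0) = (if i = 0 then e else 0)" if "i < n" for i
  proof -
    have "A' $$ (i,0) = (A' *\<^sub>v unit_vec n 0) $ i" using A' that n by simp
    then show ?thesis unfolding A'e using that n by simp
  qed
  have swap: "A' $$ (i,j) = A' $$ (j,i)" if "i < n" "j < n" for i j
    using A' A't that by (metis carrier_matD index_transpose_mat(1))
  have row0: "A' $$ (0,i) = (if i = 0 then e else 0)" if "i < n" for i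
    using col0[OF that] swap[of 0 i] that n by simp
  \<comment> \<open>The block left after deleting the first row and column of \<open>A'\<close>, to
    which the induction hypothesis will apply.\<close>
  define A3 where "A3 = mat m m (\<lambda>(i,j). A' $$ (Suc i, Suc j))"
  have A3: "A3 \<in> carrier_mat m m" by (simp add: A3_def)
  define E1 where "E1 = mat 1 1 (\<lambda>_. e)"
  have E1: "E1 \<in> carrier_mat 1 1" by (simp add: E1_def)
  have block: "A' = four_block_mat E1 (0\<^sub>m 1 m) (0\<^sub>m m 1) A3"
    using A' n by (intro eq_matI) (auto simp: A3_def E1_def row0 col0)
  have A3t: "transpose_mat A3 = A3"
    by (intro eq_matI) (auto simp: A3_def n intro!: swap)
  \<comment> \<open>As \<open>H\<close> is its own inverse, conjugation by it keeps the
    characteristic polynomial. The factor of \<open>e\<close> is then cancelled to leave that of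
    \<open>A3\<close>.\<close>
  have "similar_mat A' A"
    by (rule similar_matI[of _ _ H H n]) (use A A' H HH A'_def in auto)
  then have "char_poly A = char_poly E1 * char_poly A3"
    using char_poly_similar char_poly_four_block_zeros_col[OF E1 _ A3] block
    by (metis zero_carrier_mat)
  also have "char_poly E1 = [:- e, 1:]"
    by (simp add: E1_def char_poly_defs det_def)
  finally have "char_poly A3 = (\<Prod>e\<leftarrow>es. [:- e, 1:])"
    using Cons.prems(3) by (simp del: mult_pCons_left)
  from Cons.IH[OF A3 A3t this] obtain W where W: "W \<in> carrier_mat m m"
    and WW: "transpose_mat W * W = 1\<^sub>m m"
    and WAW: "transpose_mat W * A3 * W = mat_diag m (\<lambda>i. es ! i)"
    by (auto simp: m_def)
  \<comment> \<open>The diagonalizing matrix of the smaller block, extended by a 1 that fixes the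
    eigenvector already split off.\<close>
  define K where "K = four_block_mat (1\<^sub>m 1) (0\<^sub>m 1 m) (0\<^sub>m m 1) W"
  have K: "K \<in> carrier_mat n n" using four_block_carrier_mat[OF one_carrier_mat[of 1] W] n by (simp add: K_def)
  have Kt: "transpose_mat K = four_block_mat (1\<^sub>m 1) (0\<^sub>m 1 m) (0\<^sub>m m 1) (transpose_mat W)"
    unfolding K_def using W by (subst transpose_four_block_mat[of _ 1 1 _ m _ m]) auto
  have KK: "transpose_mat K * K = 1\<^sub>m n"
    unfolding Kt unfolding K_def using W WW n
    by (subst mult_four_block_mat[of _ 1 1 _ m _ m _ _ 1 _ m]) auto
  have KAK: "transpose_mat K * A' * K = mat_diag n (\<lambda>i. (e # es) ! i)"
  proof -
    have "transpose_mat K * A' = four_block_mat E1 (0\<^sub>m 1 m) (0\<^sub>m m 1) (transpose_mat W * A3)"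
      unfolding Kt block using W A3 E1
      by (subst mult_four_block_mat[of _ 1 1 _ m _ m _ _ 1 _ m]) auto
    also have "\<dots> * K = four_block_mat E1 (0\<^sub>m 1 m) (0\<^sub>m m 1) (transpose_mat W * A3 * W)"
      unfolding K_def using W A3 E1
      by (subst mult_four_block_mat[of _ 1 1 _ m _ m _ _ 1 _ m]) auto
    also have "\<dots> = mat_diag n (\<lambda>i. (e # es) ! i)"
      unfolding WAW using n by (intro eq_matI) (auto simp: mat_diag_def E1_def nth_Cons')
    finally show ?thesis .
  qed
  define U where "U = H * K"
  have U: "U \<in> carrier_mat n n" using H K by (simp add: U_def)
  have Ut: "transpose_mat U = transpose_mat K * H"
    unfolding U_def using H K Ht by (simp add: transpose_mult)
  have Kc: "transpose_mat K \<in> carrier_mat n n" using K by simp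
  have "transpose_mat U * U = transpose_mat K * (H * H) * K"
    unfolding Ut unfolding U_def assoc_mult_mat[OF Kc H mult_carrier_mat[OF H K]]
      assoc_mult_mat[OF Kc mult_carrier_mat[OF H H] K] assoc_mult_mat[OF H H K] ..
  also have "\<dots> = 1\<^sub>m n" using HH Kc KK by simp
  finally have 1: "transpose_mat U * U = 1\<^sub>m n" .
  have "transpose_mat U * A * U = transpose_mat K * A' * K"
    unfolding Ut unfolding U_def A'_def
    by (simp only: assoc_mult_mat[of _ n n _ n _ n] mult_carrier_mat[of _ n n _ n] H K Kc A)
  with 1 KAK U show ?case by auto
qed

text \<open>The order of a root of a product of linear factors is its multiplicity in the list of
  roots. Summing over the distinct eigenvalues with a given sign therefore counts list entries,
  which is how the counts become accessible.\<close>

lemma num_eigenvalues_split: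
  fixes A :: "real mat"
  assumes A: "A \<in> carrier_mat n n" and cp: "char_poly A = (\<Prod>e\<leftarrow>es. [:- e, 1:])"
  shows "num_pos_eigenvalues A = length (filter (\<lambda>e. 0 < e) es)"
    and "num_neg_eigenvalues A = length (filter (\<lambda>e. e < 0) es)"
proof -
  have ev: "eigenvalue A k \<longleftrightarrow> k \<in> set es" for k
    unfolding eigenvalue_root_char_poly[OF A] cp poly_prod_list
    by (auto simp: prod_list_zero_iff)
  have ord: "Polynomial.order k (char_poly A) = count (mset es) k" for k
    unfolding cp
  proof (induction es)
    case (Cons a es)
    have "(\<Prod>e\<leftarrow>es. [:- e, 1:]) \<noteq> 0" by (auto simp: prod_list_zero_iff)
    then have "Polynomial.order k ([:- a, 1:] * (\<Prod>e\<leftarrow>es. [:- e, 1:])) =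
       Polynomial.order k [:- a, 1:] + Polynomial.order k (\<Prod>e\<leftarrow>es. [:- e, 1:])"
      by (intro order_mult) (simp del: mult_pCons_left)
    then show ?case using Cons order_linear'[of k "- a"] by (auto simp del: mult_pCons_left)
  qed (auto simp: order_1_eq_0)
  have "(\<Sum>k | eigenvalue A k \<and> Q k. Polynomial.order k (char_poly A)) = length (filter Q es)" for Q
  proof -
    have "length (filter Q es) = size (mset (filter Q es))" by (simp only: size_mset)
    also have "\<dots> = (\<Sum>k\<in>set (filter Q es). count (mset (filter Q es)) k)"
      by (simp only: size_multiset_overloaded_eq set_mset_mset)
    also have "\<dots> = (\<Sum>k | eigenvalue A k \<and> Q k. Polynomial.order k (char_poly A))"
      by (intro sum.cong) (auto simp: ev ord)
    finally show ?thesis by simp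
  qed
  then show "num_pos_eigenvalues A = length (filter (\<lambda>e. 0 < e) es)"
    and "num_neg_eigenvalues A = length (filter (\<lambda>e. e < 0) es)"
    unfolding num_pos_eigenvalues_def num_neg_eigenvalues_def by this+
qed


section \<open>Sylvester's law of inertia\<close>

text \<open>A frame is encoded as an isomorphism from the coordinate space rather than as a list of
  vectors, so that a change of frame is composition with a matrix and transport of a frame is
  composition with the transport.\<close>

definition linear_frame :: "(real, 'e) module \<Rightarrow> nat \<Rightarrow> (real vec \<Rightarrow> 'e) \<Rightarrow> bool" where
  "linear_frame V n \<phi> \<longleftrightarrow>
     bij_betw \<phi> (carrier_vec n) (carrier V) \<and>
     (\<forall>a \<in> carrier_vec n. \<forall>b \<in> carrier_vec n. \<phi> (a + b) = \<phi> a \<oplus>\<^bsub>V\<^esub> \<phi> b) \<and>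
     (\<forall>c. \<forall>a \<in> carrier_vec n. \<phi> (c \<cdot>\<^sub>v a) = c \<odot>\<^bsub>V\<^esub> \<phi> a)"

lemma linear_frameD:
  assumes "linear_frame V n \<phi>"
  shows "bij_betw \<phi> (carrier_vec n) (carrier V)"
    and "a \<in> carrier_vec n \<Longrightarrow> \<phi> a \<in> carrier V"
    and "a \<in> carrier_vec n \<Longrightarrow> b \<in> carrier_vec n \<Longrightarrow> \<phi> (a + b) = \<phi> a \<oplus>\<^bsub>V\<^esub> \<phi> b"
    and "a \<in> carrier_vec n \<Longrightarrow> \<phi> (c \<cdot>\<^sub>v a) = c \<odot>\<^bsub>V\<^esub> \<phi> a"
    and "a \<in> carrier_vec n \<Longrightarrow> b \<in> carrier_vec n \<Longrightarrow> \<phi> a = \<phi> b \<longleftrightarrow> a = b"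
  using assms unfolding linear_frame_def by (auto simp: bij_betw_def inj_on_def)

lemma linear_frame_surj:
  assumes "linear_frame V n \<phi>" and "v \<in> carrier V"
  obtains a where "a \<in> carrier_vec n" "v = \<phi> a"
  using assms unfolding linear_frame_def bij_betw_def by blast

lemma linear_frame_comp_mat:
  assumes \<phi>: "linear_frame V n \<phi>" and M: "M \<in> carrier_mat n n" and N: "N \<in> carrier_mat n n"
    and inv: "N * M = 1\<^sub>m n" "M * N = 1\<^sub>m n"
  shows "linear_frame V n (\<lambda>a. \<phi> (M *\<^sub>v a))"
proof -
  have "bij_betw (\<lambda>a. M *\<^sub>v a) (carrier_vec n) (carrier_vec n)"
    by (rule bij_betw_byWitness[where f' = "\<lambda>a. N *\<^sub>v a"])
      (use M N inv in \<open>auto simp: assoc_mult_mat_vec[OF N M, symmetric] assoc_mult_mat_vec[OF M N, symmetric]\<close>)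
  from bij_betw_trans[OF this linear_frameD(1)[OF \<phi>]] show ?thesis
    using M linear_frameD[OF \<phi>]
    by (simp add: linear_frame_def o_def mult_add_distrib_mat_vec mult_mat_vec)
qed

lemma additive_homogeneous_vec:
  fixes f :: "real vec \<Rightarrow> real"
  assumes add: "\<And>a b. a \<in> carrier_vec n \<Longrightarrow> b \<in> carrier_vec n \<Longrightarrow> f (a + b) = f a + f b"
    and smult: "\<And>c a. a \<in> carrier_vec n \<Longrightarrow> f (c \<cdot>\<^sub>v a) = c * f a"
    and a: "a \<in> carrier_vec n"
  shows "f a = (\<Sum>i<n. a $ i * f (unit_vec n i))"
proof -
  \<comment> \<open>Truncations of \<open>a\<close> gain one coordinate at a time, so additivity
    yields the sum by induction on \<open>k\<close>.\<close>
  have "f (vec n (\<lambda>i. if i < k then a $ i else 0)) = (\<Sum>i<k. a $ i * f (unit_vec n i))"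
    if "k \<le> n" for k
    using that
  proof (induction k)
    case 0
    have "f (0 \<cdot>\<^sub>v a) = 0" using smult[OF a, of 0] by simp
    moreover have "0 \<cdot>\<^sub>v a = vec n (\<lambda>i. if i < 0 then a $ i else 0)"
      using a by (intro eq_vecI) auto
    ultimately show ?case by simp
  next
    case (Suc k)
    have "vec n (\<lambda>i. if i < Suc k then a $ i else 0)
        = vec n (\<lambda>i. if i < k then a $ i else 0) + a $ k \<cdot>\<^sub>v unit_vec n k"
      using Suc.prems by (intro eq_vecI) (auto simp: less_Suc_eq)
    then show ?case using Suc by (simp add: add smult)
  qed
  moreover have "vec n (\<lambda>i. if i < n then a $ i else 0) = a"
    using a by (intro eq_vecI) auto
  ultimately show ?thesis by (metis order_refl)
qed

text \<open>The coefficients of the functionals fill the first \<open>m\<close> rows of a square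
  matrix whose other rows are zero. Row \<open>m\<close> vanishes, so the determinant is zero and
  the matrix has a nonzero kernel vector.\<close>

lemma linear_functionals_common_zero:
  fixes f :: "nat \<Rightarrow> real vec \<Rightarrow> real"
  assumes add: "\<And>i a b. a \<in> carrier_vec n \<Longrightarrow> b \<in> carrier_vec n \<Longrightarrow> f i (a + b) = f i a + f i b"
    and smult: "\<And>i c a. a \<in> carrier_vec n \<Longrightarrow> f i (c \<cdot>\<^sub>v a) = c * f i a"
    and m: "m < n"
  obtains a where "a \<in> carrier_vec n" "a \<noteq> 0\<^sub>v n" "\<And>i. i < m \<Longrightarrow> f i a = 0"
proof -
  define M where "M = mat n n (\<lambda>(i,j). if i < m then f i (unit_vec n j) else 0)"
  have M: "M \<in> carrier_mat n n" by (simp add: M_def)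
  have "transpose_mat M *\<^sub>v unit_vec n m = 0\<^sub>v n"
    using m by (intro eq_vecI) (auto simp: M_def)
  moreover have "unit_vec n m \<noteq> (0\<^sub>v n :: real vec)"
    using m by (metis index_unit_vec(1) index_zero_vec(1) zero_neq_one)
  ultimately have "det (transpose_mat M) = 0"
    using det_0_iff_vec_prod_zero[of "transpose_mat M" n] M
    by (metis transpose_carrier_mat unit_vec_carrier)
  then have "det M = 0" using det_transpose[OF M] by simp
  then obtain a where a: "a \<in> carrier_vec n" "a \<noteq> 0\<^sub>v n" "M *\<^sub>v a = 0\<^sub>v n"
    using det_0_iff_vec_prod_zero[OF M] by blast
  have "f i a = 0" if "i < m" for i
  proof -
    have "f i a = (\<Sum>j<n. a $ j * f i (unit_vec n j))"
      by (rule additive_homogeneous_vec) (use add smult a in auto)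
    also have "\<dots> = (M *\<^sub>v a) $ i"
      using that m a(1) by (simp add: M_def scalar_prod_def atLeast0LessThan mult.commute)
    finally show ?thesis using a that m by simp
  qed
  with a that show ?thesis by blast
qed

text \<open>The standard form with \<open>p\<close> plus signs and \<open>n - p\<close> minus signs.
  Once \<open>p\<close> reaches \<open>n\<close> all signs are positive and larger values give the
  same form, hence the bounds by \<open>n\<close> in the law of inertia.\<close>

definition signed_prod :: "nat \<Rightarrow> nat \<Rightarrow> real vec \<Rightarrow> real vec \<Rightarrow> real" where
  "signed_prod n p a b = (\<Sum>i<n. (if i < p then 1 else - 1) * (a $ i * b $ i))"

text \<open>If \<open>q < p\<close>, the \<open>p\<close>-dimensional space on which the first
  normal form is positive and the \<open>(n - q)\<close>-dimensional space on which the second is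
  nonpositive have dimensions adding up to more than \<open>n\<close>. A common nonzero vector would
  have a value of \<open>h\<close> both positive and at most zero.\<close>

lemma sylvester_inertia_le:
  assumes \<phi>: "linear_frame V n \<phi>" and \<psi>: "linear_frame V n \<psi>"
    and h\<phi>: "\<And>a. a \<in> carrier_vec n \<Longrightarrow> h (\<phi> a) (\<phi> a) = signed_prod n p a a"
    and h\<psi>: "\<And>a. a \<in> carrier_vec n \<Longrightarrow> h (\<psi> a) (\<psi> a) = signed_prod n q a a"
    and p: "p \<le> n"
  shows "p \<le> q"
proof (rule ccontr)
  assume "\<not> p \<le> q"
  \<comment> \<open>The change of coordinates from the first frame to the second; its linearity
    makes the coordinates of \<open>Z a\<close> linear functionals of \<open>a\<close>.\<close>
  define Z where "Z a = the_inv_into (carrier_vec n) \<psi> (\<phi> a)" for a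
  have Z: "Z a \<in> carrier_vec n" "\<psi> (Z a) = \<phi> a" if "a \<in> carrier_vec n" for a
  proof -
    have "\<phi> a \<in> \<psi> ` carrier_vec n" and inj: "inj_on \<psi> (carrier_vec n)"
      using linear_frameD(1,2)[OF \<phi>] linear_frameD(1)[OF \<psi>] that by (auto simp: bij_betw_def)
    then show "Z a \<in> carrier_vec n" "\<psi> (Z a) = \<phi> a"
      unfolding Z_def by (auto intro: the_inv_into_into f_the_inv_into_f)
  qed
  have Zadd: "Z (a + b) = Z a + Z b" if "a \<in> carrier_vec n" "b \<in> carrier_vec n" for a b
  proof -
    have "\<psi> (Z (a + b)) = \<psi> (Z a + Z b)"
      using that Z by (simp add: linear_frameD(3)[OF \<phi>] linear_frameD(3)[OF \<psi>])
    then show ?thesis using that Z(1) by (simp add: linear_frameD(5)[OF \<psi>])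
  qed
  have Zsmult: "Z (c \<cdot>\<^sub>v a) = c \<cdot>\<^sub>v Z a" if "a \<in> carrier_vec n" for a c
  proof -
    have "\<psi> (Z (c \<cdot>\<^sub>v a)) = \<psi> (c \<cdot>\<^sub>v Z a)"
      using that Z by (simp add: linear_frameD(4)[OF \<phi>] linear_frameD(4)[OF \<psi>])
    then show ?thesis using that Z(1) by (simp add: linear_frameD(5)[OF \<psi>])
  qed
  have Zdim: "dim_vec (Z a) = n" if "a \<in> carrier_vec n" for a
    using Z(1)[OF that] by simp
  \<comment> \<open>Fewer than \<open>n\<close> conditions put \<open>a\<close> in the positive part of the first form and its image in
    the negative part of the second; the guard \<open>i < q + (n - p)\<close> below avoids entries out of range.\<close>
  define f where "f i a = (if i < q then Z a $ i else a $ (i - q + p))" for i a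
  obtain a where a: "a \<in> carrier_vec n" "a \<noteq> 0\<^sub>v n" and f0: "\<And>i. i < q + (n - p) \<Longrightarrow> f i a = 0"
  proof (rule linear_functionals_common_zero[of n "\<lambda>i. if i < q + (n - p) then f i else (\<lambda>_. 0)"
        "q + (n - p)"])
    show "q + (n - p) < n" using p \<open>\<not> p \<le> q\<close> by simp
  qed (use Zdim p \<open>\<not> p \<le> q\<close> in \<open>auto simp: f_def Zadd Zsmult\<close>)
  have a0: "a $ i = 0" if "p \<le> i" "i < n" for i
    using f0[of "q + (i - p)"] that by (auto simp: f_def simp del: add_diff_assoc)
  have Z0: "Z a $ i = 0" if "i < q" for i
    using f0[of i] that by (simp add: f_def)
  obtain i where i: "i < n" "a $ i \<noteq> 0"
    using a by (metis carrier_vecD eq_vecI index_zero_vec)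
  have "0 < (\<Sum>i<n. a $ i * a $ i)"
    by (rule sum_pos2[where i = i]) (use i in \<open>auto simp: less_le not_square_less_zero\<close>)
  also have "\<dots> = signed_prod n p a a"
    unfolding signed_prod_def using a0 by (intro sum.cong) auto
  also have "\<dots> = signed_prod n q (Z a) (Z a)"
    using h\<phi> h\<psi> Z a by metis
  also have "\<dots> \<le> 0"
    unfolding signed_prod_def using Z0 by (intro sum_nonpos) auto
  finally show False by simp
qed


section \<open>Normal form of a metric\<close>

text \<open>A coordinate vector is sent to the linear combination of the basis with these
  coefficients; uniqueness and existence of coordinates give bijectivity.\<close>

lemma ordered_basis_frame:
  assumes V: "vectorspace class_ring V" and es: "ordered_basis V es"
  obtains \<phi> where "linear_frame V (length es) \<phi>"
    and "\<And>i. i < length es \<Longrightarrow> \<phi> (unit_vec (length es) i) = es ! i"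
proof -
  interpret vectorspace class_ring V by (rule V)
  let ?n = "length es" and ?A = "set es"
  have dist: "distinct es" and basis: "basis ?A" using es by (auto simp: ordered_basis_def)
  have A: "?A \<subseteq> carrier V" using basis by (simp add: basis_def)
  have uniq: "\<exists>!c. c \<in> ?A \<rightarrow>\<^sub>E UNIV \<and> lincomb c ?A = v" if "v \<in> carrier V" for v
    using basis_criterion[of ?A] A basis that by simp
  \<comment> \<open>Coefficients in \<open>lincomb\<close> are indexed by the vectors themselves, so
    each basis vector needs its position in the list.\<close>
  define idx where "idx = the_inv_into {..<?n} ((!) es)"
  have idx [simp]: "idx (es ! i) = i" if "i < ?n" for i
    unfolding idx_def by (rule the_inv_into_f_f) (use that dist in \<open>auto intro: inj_on_nth\<close>)
  have idx_less: "idx e < ?n" if "e \<in> ?A" for e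
    using that by (metis idx in_set_conv_nth)
  have nth_idx: "es ! idx e = e" if "e \<in> ?A" for e
    using that by (metis idx in_set_conv_nth)
  define \<phi> where "\<phi> a = lincomb (\<lambda>e. a $ idx e) ?A" for a
  have cong: "lincomb c ?A = lincomb d ?A" if "\<And>e. e \<in> ?A \<Longrightarrow> c e = d e" for c d
    by (rule lincomb_cong[OF refl A]) (use that in auto)
  have "linear_frame V ?n \<phi>"
    unfolding linear_frame_def
  proof (intro conjI ballI allI)
    show "bij_betw \<phi> (carrier_vec ?n) (carrier V)"
    proof (rule bij_betw_imageI)
      show "inj_on \<phi> (carrier_vec ?n)"
      proof (rule inj_onI)
        fix a b assume ab: "a \<in> carrier_vec ?n" "b \<in> carrier_vec ?n" "\<phi> a = \<phi> b"
        \<comment> \<open>Uniqueness of coordinates holds among coefficient functions that are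
          \<open>undefined\<close> off the basis, so the coefficients are restricted before they are
          compared.\<close>
        have "lincomb (restrict (\<lambda>e. x $ idx e) ?A) ?A = \<phi> x" for x
          unfolding \<phi>_def by (rule cong) simp
        moreover have "\<phi> a \<in> carrier V" unfolding \<phi>_def using A by simp
        ultimately have "restrict (\<lambda>e. a $ idx e) ?A = restrict (\<lambda>e. b $ idx e) ?A"
          using uniq[of "\<phi> a"] ab(3) by (metis UNIV_I restrict_PiE_iff)
        then have "a $ i = b $ i" if "i < ?n" for i
          using that idx[OF that] nth_mem[OF that] by (metis restrict_apply')
        with ab(1,2) show "a = b" by (intro eq_vecI) auto
      qed
      show "\<phi> ` carrier_vec ?n = carrier V"
      proof
        show "\<phi> ` carrier_vec ?n \<subseteq> carrier V" unfolding \<phi>_def using A by auto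
        show "carrier V \<subseteq> \<phi> ` carrier_vec ?n"
        proof
          fix v assume "v \<in> carrier V"
          then obtain c where c: "lincomb c ?A = v" using uniq by blast
          have "\<phi> (vec ?n (\<lambda>i. c (es ! i))) = lincomb c ?A"
            unfolding \<phi>_def by (rule cong) (simp add: idx_less nth_idx)
          with c show "v \<in> \<phi> ` carrier_vec ?n" by (metis image_eqI vec_carrier)
        qed
      qed
    qed
  next
    fix a b :: "real vec" assume ab: "a \<in> carrier_vec ?n" "b \<in> carrier_vec ?n"
    have "\<phi> (a + b) = lincomb (\<lambda>e. a $ idx e + b $ idx e) ?A"
      unfolding \<phi>_def by (rule cong) (use ab idx_less in simp)
    also have "\<dots> = \<phi> a \<oplus>\<^bsub>V\<^esub> \<phi> b"
      unfolding \<phi>_def using lincomb_sum[OF _ A, of "\<lambda>e. a $ idx e" "\<lambda>e. b $ idx e"] by simp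
    finally show "\<phi> (a + b) = \<phi> a \<oplus>\<^bsub>V\<^esub> \<phi> b" .
  next
    fix c :: real and a :: "real vec" assume a: "a \<in> carrier_vec ?n"
    have "\<phi> (c \<cdot>\<^sub>v a) = lincomb (\<lambda>e. c * a $ idx e) ?A"
      unfolding \<phi>_def by (rule cong) (use a idx_less in simp)
    also have "\<dots> = c \<odot>\<^bsub>V\<^esub> \<phi> a"
      unfolding \<phi>_def using lincomb_smult[OF A, of "\<lambda>e. a $ idx e" c] by simp
    finally show "\<phi> (c \<cdot>\<^sub>v a) = c \<odot>\<^bsub>V\<^esub> \<phi> a" .
  qed
  moreover have "\<phi> (unit_vec ?n i) = es ! i" if i: "i < ?n" for i
  proof -
    have ei: "es ! i \<in> ?A" "es ! i \<in> carrier V" using i A by auto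
    have "\<phi> (unit_vec ?n i) = lincomb (\<lambda>e. if e = es ! i then 1 else 0) ?A"
      unfolding \<phi>_def by (rule cong) (use i idx_less nth_idx in \<open>auto simp: unit_vec_def\<close>)
    also have "\<dots> = 1 \<odot>\<^bsub>V\<^esub> es ! i \<oplus>\<^bsub>V\<^esub> lincomb (\<lambda>e. if e = es ! i then 1 else 0) (?A - {es ! i})"
      using lincomb_del2[OF _ A _ ei(1), of "\<lambda>e. if e = es ! i then 1 else 0"] by simp
    also have "lincomb (\<lambda>e. if e = es ! i then 1 else 0) (?A - {es ! i}) = \<zero>\<^bsub>V\<^esub>"
      by (rule lincomb_zero) (use A in auto)
    also have "1 \<odot>\<^bsub>V\<^esub> es ! i \<oplus>\<^bsub>V\<^esub> \<zero>\<^bsub>V\<^esub> = es ! i"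
      using ei(2) smult_one by simp
    finally show ?thesis .
  qed
  ultimately show ?thesis using that by blast
qed

definition metric_on :: "(real, 'e) module \<Rightarrow> ('e \<Rightarrow> 'e \<Rightarrow> real) \<Rightarrow> bool" where
  "metric_on V h \<longleftrightarrow>
     (\<forall>u \<in> carrier V. \<forall>v \<in> carrier V. \<forall>w \<in> carrier V.
        h (u \<oplus>\<^bsub>V\<^esub> v) w = h u w + h v w \<and> h w (u \<oplus>\<^bsub>V\<^esub> v) = h w u + h w v) \<and>
     (\<forall>c. \<forall>u \<in> carrier V. \<forall>v \<in> carrier V.
        h (c \<odot>\<^bsub>V\<^esub> u) v = c * h u v \<and> h u (c \<odot>\<^bsub>V\<^esub> v) = c * h u v) \<and>
     (\<forall>u \<in> carrier V. \<forall>v \<in> carrier V. h u v = h v u) \<and>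
     (\<forall>u \<in> carrier V. (\<forall>v \<in> carrier V. h u v = 0) \<longrightarrow> u = \<zero>\<^bsub>V\<^esub>)"

lemma bundle_metric_iff: "bundle_metric B F g \<longleftrightarrow> (\<forall>x \<in> topspace B. metric_on (F x) (g x))"
  unfolding bundle_metric_def metric_on_def ..

lemma metric_onD:
  assumes "metric_on V h" "u \<in> carrier V" "v \<in> carrier V"
  shows "w \<in> carrier V \<Longrightarrow> h (u \<oplus>\<^bsub>V\<^esub> v) w = h u w + h v w"
    and "w \<in> carrier V \<Longrightarrow> h w (u \<oplus>\<^bsub>V\<^esub> v) = h w u + h w v"
    and "h (c \<odot>\<^bsub>V\<^esub> u) v = c * h u v" and "h u (c \<odot>\<^bsub>V\<^esub> v) = c * h u v"
    and "h u v = h v u"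
  using assms unfolding metric_on_def by auto

lemma metric_on_frame:
  assumes h: "metric_on V h" and \<phi>: "linear_frame V n \<phi>"
    and a: "a \<in> carrier_vec n" and b: "b \<in> carrier_vec n"
  shows "h (\<phi> a) (\<phi> b) =
    a \<bullet> (mat n n (\<lambda>(i,j). h (\<phi> (unit_vec n i)) (\<phi> (unit_vec n j))) *\<^sub>v b)"
proof -
  note [simp] = linear_frameD(2-4)[OF \<phi>] metric_onD[OF h]
  have "h (\<phi> a) (\<phi> b) = (\<Sum>i<n. a $ i * h (\<phi> (unit_vec n i)) (\<phi> b))"
    by (rule additive_homogeneous_vec[of n "\<lambda>a. h (\<phi> a) (\<phi> b)"]) (use a b in auto)
  also have "\<dots> = (\<Sum>i<n. a $ i * (\<Sum>j<n. b $ j * h (\<phi> (unit_vec n i)) (\<phi> (unit_vec n j))))"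
    by (intro sum.cong refl arg_cong2[where f = "(*)"] additive_homogeneous_vec[where n = n])
      (use a b in auto)
  also have "\<dots> = a \<bullet> (mat n n (\<lambda>(i,j). h (\<phi> (unit_vec n i)) (\<phi> (unit_vec n j))) *\<^sub>v b)"
    using a b by (simp add: scalar_prod_def atLeast0LessThan mult.commute)
  finally show ?thesis .
qed

text \<open>The Gram matrix is diagonalized orthogonally and each axis is rescaled to make its entry
  1 or -1. Nondegeneracy excludes the eigenvalue zero, so positive and negative eigenvalues together
  number \<open>n\<close>.\<close>

lemma metric_normal_frame:
  assumes V: "vectorspace class_ring V" and h: "metric_on V h" and es: "ordered_basis V es"
    and n: "n = length es"
  obtains \<phi> where "linear_frame V n \<phi>"
    and "\<And>a b. a \<in> carrier_vec n \<Longrightarrow> b \<in> carrier_vec n \<Longrightarrow>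
      h (\<phi> a) (\<phi> b) = signed_prod n (num_pos_eigenvalues (gram_matrix h es)) a b"
    and "num_pos_eigenvalues (gram_matrix h es) + num_neg_eigenvalues (gram_matrix h es) = n"
proof -
  interpret V: vectorspace class_ring V by (rule V)
  obtain \<phi> where \<phi>: "linear_frame V n \<phi>" and \<phi>e: "\<And>i. i < n \<Longrightarrow> \<phi> (unit_vec n i) = es ! i"
    using ordered_basis_frame[OF V es] n by metis
  define G where "G = gram_matrix h es"
  have G: "G \<in> carrier_mat n n" by (simp add: G_def gram_matrix_def n)
  have esV: "es ! i \<in> carrier V" if "i < n" for i
    using linear_frameD(2)[OF \<phi>, of "unit_vec n i"] \<phi>e[OF that] by simp
  have Gt: "transpose_mat G = G"
    by (intro eq_matI) (auto simp: G_def gram_matrix_def esV n[symmetric] metric_onD(5)[OF h])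
  have Geq: "G = mat n n (\<lambda>(i,j). h (\<phi> (unit_vec n i)) (\<phi> (unit_vec n j)))"
    by (intro eq_matI) (auto simp: G_def gram_matrix_def n[symmetric] \<phi>e)
  have hG: "h (\<phi> a) (\<phi> b) = a \<bullet> (G *\<^sub>v b)" if "a \<in> carrier_vec n" "b \<in> carrier_vec n" for a b
    unfolding Geq by (rule metric_on_frame[OF h \<phi> that])
  have zero: "\<phi> (0\<^sub>v n) = \<zero>\<^bsub>V\<^esub>"
  proof -
    have "0 \<cdot>\<^sub>v 0\<^sub>v n = (0\<^sub>v n :: real vec)" by (intro eq_vecI) auto
    then show ?thesis
      using linear_frameD(4)[OF \<phi>, of "0\<^sub>v n" 0] linear_frameD(2)[OF \<phi>, of "0\<^sub>v n"]
        V.smult_l_null by simp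
  qed
  \<comment> \<open>A kernel vector of the Gram matrix represents a vector orthogonal to the whole
    fibre, which nondegeneracy forces to be zero.\<close>
  have ker: "b = 0\<^sub>v n" if b: "b \<in> carrier_vec n" and Gb: "G *\<^sub>v b = 0\<^sub>v n" for b
  proof -
    have "h (\<phi> b) v = 0" if v: "v \<in> carrier V" for v
    proof -
      obtain a where "a \<in> carrier_vec n" "v = \<phi> a"
        using linear_frame_surj[OF \<phi> v] .
      then show ?thesis
        using hG[of a b] b Gb metric_onD(5)[OF h] linear_frameD(2)[OF \<phi>] by auto
    qed
    then have "\<phi> b = \<zero>\<^bsub>V\<^esub>" using h linear_frameD(2)[OF \<phi> b] unfolding metric_on_def by blast
    then show ?thesis using zero linear_frameD(5)[OF \<phi> b, of "0\<^sub>v n"] by simp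
  qed
  obtain es0 where cp0: "char_poly G = (\<Prod>e\<leftarrow>es0. [:- e, 1:])" and len0: "length es0 = n"
    using char_poly_symmetric_splits[OF G Gt] .
  \<comment> \<open>Listing the positive eigenvalues first makes the normal form depend on their number only.\<close>
  define ds where "ds = filter (\<lambda>e. 0 < e) es0 @ filter (\<lambda>e. \<not> 0 < e) es0"
  have "mset ds = mset es0" by (simp add: ds_def)
  then have len: "length ds = n" and "mset (map (\<lambda>e. [:- e, 1:]) ds) = mset (map (\<lambda>e. [:- e, 1:]) es0)"
    using len0 by (auto dest: mset_eq_length)
  then have cp: "char_poly G = (\<Prod>e\<leftarrow>ds. [:- e, 1:])"
    unfolding cp0 by (metis prod_mset_prod_list)
  have nz: "e \<noteq> 0" if "e \<in> set ds" for e
  proof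
    assume "e = 0"
    with that have "eigenvalue G 0"
      unfolding eigenvalue_root_char_poly[OF G] cp poly_prod_list by (auto simp: prod_list_zero_iff)
    then obtain v where v: "v \<in> carrier_vec n" "v \<noteq> 0\<^sub>v n" "G *\<^sub>v v = 0 \<cdot>\<^sub>v v"
      using G unfolding eigenvalue_def eigenvector_def by auto
    have "0 \<cdot>\<^sub>v v = 0\<^sub>v n" using v(1) by (intro eq_vecI) auto
    then show False using ker v by simp
  qed
  define p where "p = num_pos_eigenvalues G"
  have p: "p = length (filter (\<lambda>e. 0 < e) es0)"
    unfolding p_def using num_eigenvalues_split(1)[OF G cp0] .
  have "num_neg_eigenvalues G = length (filter (\<lambda>e. e < 0) ds)"
    using num_eigenvalues_split(2)[OF G cp] .
  moreover have "p = length (filter (\<lambda>e. 0 < e) ds)"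
    unfolding p_def using num_eigenvalues_split(1)[OF G cp] .
  moreover have "filter (\<lambda>e. e < 0) ds = filter (\<lambda>e. \<not> 0 < e) ds"
    using nz by (intro filter_cong) (auto simp: less_le)
  ultimately have pq: "p + num_neg_eigenvalues G = n"
    using sum_length_filter_compl[of "\<lambda>e. 0 < e" ds] len by simp
  have sgn: "0 < ds ! i \<longleftrightarrow> i < p" if "i < n" for i
  proof (cases "i < p")
    case True
    then show ?thesis using nth_mem[of i "filter (\<lambda>e. 0 < e) es0"] by (auto simp: ds_def p nth_append)
  next
    case False
    then show ?thesis using nth_mem[of "i - p" "filter (\<lambda>e. \<not> 0 < e) es0"] that len
      by (auto simp: ds_def p nth_append)
  qed
  obtain U where U: "U \<in> carrier_mat n n" and UU: "transpose_mat U * U = 1\<^sub>m n"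
    and UGU: "transpose_mat U * G * U = mat_diag n (\<lambda>i. ds ! i)"
    using symmetric_orthogonally_diagonalizable[OF G Gt cp len] by blast
  have Ut: "transpose_mat U \<in> carrier_mat n n" using U by simp
  have UU': "U * transpose_mat U = 1\<^sub>m n" by (rule mat_mult_left_right_inverse[OF Ut U UU])
  \<comment> \<open>Dividing the axis \<open>i\<close> by the root of the absolute eigenvalue leaves
    only its sign. The eigenvalues are nonzero, so the scaling \<open>S\<close> has the inverse
    \<open>T\<close> and the rescaled map is still a frame.\<close>
  define r where "r i = sqrt \<bar>ds ! i\<bar>" for i
  have r: "r i > 0" if "i < n" for i using nz[of "ds ! i"] that len by (simp add: r_def)
  define S T where "S = mat_diag n (\<lambda>i. 1 / r i)" and "T = mat_diag n r"
  have S: "S \<in> carrier_mat n n" and T: "T \<in> carrier_mat n n" by (simp_all add: S_def T_def)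
  have ST: "S * T = 1\<^sub>m n" "T * S = 1\<^sub>m n"
    unfolding S_def T_def mat_diag_diag
    by (intro eq_matI; use r in \<open>force simp: mat_diag_def\<close>)+
  define \<psi> where "\<psi> a = \<phi> (U *\<^sub>v (S *\<^sub>v a))" for a
  have "linear_frame V n (\<lambda>a. \<phi> (U *\<^sub>v a))"
    by (rule linear_frame_comp_mat[OF \<phi> U Ut UU UU'])
  then have \<psi>: "linear_frame V n \<psi>"
    unfolding \<psi>_def by (rule linear_frame_comp_mat[OF _ S T ST(2,1)])
  have "h (\<psi> a) (\<psi> b) = signed_prod n p a b" if a: "a \<in> carrier_vec n" and b: "b \<in> carrier_vec n" for a b
  proof -
    have Sa: "S *\<^sub>v a \<in> carrier_vec n" and Sb: "S *\<^sub>v b \<in> carrier_vec n" using S a b by auto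
    have GU: "G * U \<in> carrier_mat n n" using G U by simp
    have "h (\<psi> a) (\<psi> b) = (U *\<^sub>v (S *\<^sub>v a)) \<bullet> (G *\<^sub>v (U *\<^sub>v (S *\<^sub>v b)))"
      unfolding \<psi>_def by (rule hG) (use U Sa Sb in auto)
    also have "\<dots> = (U *\<^sub>v (S *\<^sub>v a)) \<bullet> ((G * U) *\<^sub>v (S *\<^sub>v b))"
      by (simp only: assoc_mult_mat_vec[OF G U Sb])
    also have "\<dots> = (S *\<^sub>v a) \<bullet> (transpose_mat U *\<^sub>v ((G * U) *\<^sub>v (S *\<^sub>v b)))"
      using transpose_vec_mult_scalar[OF Ut, of "(G * U) *\<^sub>v (S *\<^sub>v b)" "S *\<^sub>v a"] Sa Sb GU U
      by (metis comm_scalar_prod mult_mat_vec_carrier transpose_transpose Ut)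
    also have "\<dots> = (S *\<^sub>v a) \<bullet> (mat_diag n (\<lambda>i. ds ! i) *\<^sub>v (S *\<^sub>v b))"
      by (simp only: UGU[symmetric] assoc_mult_mat[OF Ut G U] assoc_mult_mat_vec[OF Ut GU Sb])
    also have "\<dots> = (\<Sum>i<n. (S *\<^sub>v a) $ i * (ds ! i * (S *\<^sub>v b) $ i))"
    proof -
      have "(mat_diag n (\<lambda>i. ds ! i) *\<^sub>v x) $ i = ds ! i * x $ i" if "i < n" "x \<in> carrier_vec n" for i x
        using that by (simp add: mat_diag_def scalar_prod_def if_distrib[where f = "\<lambda>c. c * _"] sum.delta cong: if_cong)
      moreover have "dim_vec (mat_diag n (\<lambda>i. ds ! i) *\<^sub>v (S *\<^sub>v b)) = n"
        using mult_mat_vec_carrier[OF mat_diag_dim Sb] by (rule carrier_vecD)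
      ultimately show ?thesis
        using Sb unfolding scalar_prod_def[of "S *\<^sub>v a"] by (simp add: atLeast0LessThan del: index_mult_mat_vec)
    qed
    also have "\<dots> = signed_prod n p a b"
      unfolding signed_prod_def
    proof (intro sum.cong refl)
      fix i assume "i \<in> {..<n}"
      then have i: "i < n" by simp
      have Sx: "(S *\<^sub>v x) $ i = x $ i / r i" if "x \<in> carrier_vec n" for x
        using that i by (simp add: S_def mat_diag_def scalar_prod_def if_distrib[where f = "\<lambda>c. c * _"] sum.delta cong: if_cong)
      have "ds ! i = (if i < p then 1 else - 1) * (r i)\<^sup>2"
        using sgn[OF i] by (auto simp: r_def)
      then show "(S *\<^sub>v a) $ i * (ds ! i * (S *\<^sub>v b) $ i) = (if i < p then 1 else - 1) * (a $ i * b $ i)"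
        using r[OF i] by (simp add: Sx a b power2_eq_square)
    qed
    finally show ?thesis .
  qed
  with \<psi> pq show ?thesis using that by (auto simp: G_def p_def)
qed


lemma sylvester_inertia:
  assumes "linear_frame V n \<phi>" and "linear_frame V n \<psi>"
    and "\<And>a. a \<in> carrier_vec n \<Longrightarrow> h (\<phi> a) (\<phi> a) = signed_prod n p a a"
    and "\<And>a. a \<in> carrier_vec n \<Longrightarrow> h (\<psi> a) (\<psi> a) = signed_prod n q a a"
    and "p \<le> n" and "q \<le> n"
  shows "p = q"
proof (rule order_antisym)
  show "p \<le> q" by (rule sylvester_inertia_le[where h = h and \<phi> = \<phi> and \<psi> = \<psi>]) (use assms in auto)
  show "q \<le> p" by (rule sylvester_inertia_le[where h = h and \<phi> = \<psi> and \<psi> = \<phi>]) (use assms in auto)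
qed

text \<open>Everything that is needed about one fibre. A normal frame is built from one basis;
  inertia compares it with the normal frame of any other basis, so both have the same
  \<open>p\<close>, and the signature is p - (n - p).\<close>

lemma metric_inertia:
  assumes V: "vectorspace class_ring V" and fd: "vectorspace.fin_dim class_ring V"
    and dim: "vectorspace.dim class_ring V = n" and h: "metric_on V h"
  shows "\<exists>\<phi> p. linear_frame V n \<phi> \<and> p \<le> n \<and>
    (\<forall>a \<in> carrier_vec n. \<forall>b \<in> carrier_vec n. h (\<phi> a) (\<phi> b) = signed_prod n p a b) \<and>
    (\<exists>es. ordered_basis V es) \<and>
    (\<forall>es. ordered_basis V es \<longrightarrow> signature (gram_matrix h es) = 2 * int p - int n)"
proof -
  interpret vectorspace class_ring V by (rule V)
  have len: "length es = n" if "ordered_basis V es" for es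
    using that dim dim_basis[of "set es"] by (auto simp: ordered_basis_def distinct_card)
  obtain A where "finite A" "basis A" using finite_basis_exists[OF fd] by blast
  then obtain es where es: "ordered_basis V es"
    unfolding ordered_basis_def using finite_distinct_list by metis
  let ?p = "\<lambda>es. num_pos_eigenvalues (gram_matrix h es)"
  obtain \<phi> where \<phi>: "linear_frame V n \<phi>"
    and h\<phi>: "\<And>a b. a \<in> carrier_vec n \<Longrightarrow> b \<in> carrier_vec n \<Longrightarrow> h (\<phi> a) (\<phi> b) = signed_prod n (?p es) a b"
    and p: "?p es + num_neg_eigenvalues (gram_matrix h es) = n"
    using metric_normal_frame[OF V h es len[OF es, symmetric]] by blast
  have "signature (gram_matrix h ds) = 2 * int (?p es) - int n" if ds: "ordered_basis V ds" for ds
  proof -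
    obtain \<psi> where \<psi>: "linear_frame V n \<psi>"
      and h\<psi>: "\<And>a b. a \<in> carrier_vec n \<Longrightarrow> b \<in> carrier_vec n \<Longrightarrow> h (\<psi> a) (\<psi> b) = signed_prod n (?p ds) a b"
      and q: "?p ds + num_neg_eigenvalues (gram_matrix h ds) = n"
      using metric_normal_frame[OF V h ds len[OF ds, symmetric]] by blast
    have "?p es = ?p ds"
      by (rule sylvester_inertia[where h = h, OF \<phi> \<psi>]) (use h\<phi> h\<psi> p q in auto)
    then show ?thesis using q by (simp add: signature_def)
  qed
  with \<phi> h\<phi> p es show ?thesis by (intro exI[of _ \<phi>] exI[of _ "?p es"]) auto
qed

section \<open>Transports along paths\<close>

definition frame_transport :: "nat \<Rightarrow> ('b \<Rightarrow> real vec \<Rightarrow> 'e) \<Rightarrow> ('b, 'e) transport" where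
  "frame_transport n \<phi> J \<gamma> s t u = \<phi> (\<gamma> t) (the_inv_into (carrier_vec n) (\<phi> (\<gamma> s)) u)"

lemma frame_transport_apply:
  assumes "linear_frame V n (\<phi> (\<gamma> s))" and "a \<in> carrier_vec n"
  shows "frame_transport n \<phi> J \<gamma> s t (\<phi> (\<gamma> s) a) = \<phi> (\<gamma> t) a"
  using linear_frameD(1)[OF assms(1)] assms(2)
  by (simp add: frame_transport_def bij_betw_def the_inv_into_f_f)

text \<open>The transport passes through the common coordinate space: coordinates are read off at
  the start and used again at the end. In a composition the middle frame cancels against its
  inverse, which gives both transport laws.\<close>

lemma linear_transport_frame_transport:
  assumes frame: "\<And>x. x \<in> X \<Longrightarrow> linear_frame (F x) n (\<phi> x)"
    and P: "\<And>J \<gamma> s. (J, \<gamma>) \<in> P \<Longrightarrow> s \<in> J \<Longrightarrow> \<gamma> s \<in> X"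
  shows "linear_transport P F (frame_transport n \<phi>)"
proof -
  let ?L = "frame_transport n \<phi>"
  have surj: "\<exists>a \<in> carrier_vec n. u = \<phi> x a" if "x \<in> X" "u \<in> carrier (F x)" for x u
    using linear_frame_surj[OF frame[OF that(1)] that(2)] by metis
  show ?thesis
    unfolding linear_transport_def
  proof (clarify, intro conjI ballI)
    fix J \<gamma> s t assume J: "(J, \<gamma>) \<in> P" "s \<in> J" "t \<in> J"
    note s = frame[OF P[OF J(1,2)]] and t = frame[OF P[OF J(1,3)]]
    note apply_s = frame_transport_apply[where \<phi> = \<phi> and \<gamma> = \<gamma> and s = s, OF s]
    show "?L J \<gamma> s t \<in> LinearCombinations.module_hom class_ring (F (\<gamma> s)) (F (\<gamma> t))"
      unfolding LinearCombinations.module_hom_def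
    proof (intro CollectI conjI allI impI funcsetI; (elim conjE)?)
      fix u assume "u \<in> carrier (F (\<gamma> s))"
      then show "?L J \<gamma> s t u \<in> carrier (F (\<gamma> t))"
        using surj[OF P[OF J(1,2)]] apply_s linear_frameD(2)[OF t] by metis
    next
      fix u v assume "u \<in> carrier (F (\<gamma> s))" "v \<in> carrier (F (\<gamma> s))"
      then obtain a b where ab: "a \<in> carrier_vec n" "b \<in> carrier_vec n" "u = \<phi> (\<gamma> s) a" "v = \<phi> (\<gamma> s) b"
        using surj[OF P[OF J(1,2)]] by metis
      then show "?L J \<gamma> s t (u \<oplus>\<^bsub>F (\<gamma> s)\<^esub> v) = ?L J \<gamma> s t u \<oplus>\<^bsub>F (\<gamma> t)\<^esub> ?L J \<gamma> s t v"
        by (simp add: apply_s linear_frameD(3)[OF t] flip: linear_frameD(3)[OF s])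
    next
      fix c u assume "u \<in> carrier (F (\<gamma> s))"
      then obtain a where a: "a \<in> carrier_vec n" "u = \<phi> (\<gamma> s) a"
        using surj[OF P[OF J(1,2)]] by metis
      then show "?L J \<gamma> s t (c \<odot>\<^bsub>F (\<gamma> s)\<^esub> u) = c \<odot>\<^bsub>F (\<gamma> t)\<^esub> ?L J \<gamma> s t u"
        by (simp add: apply_s linear_frameD(4)[OF t] flip: linear_frameD(4)[OF s])
    qed
  next
    fix J \<gamma> r s t u assume J: "(J, \<gamma>) \<in> P" "r \<in> J" "s \<in> J" "t \<in> J" and "u \<in> carrier (F (\<gamma> s))"
    then obtain a where a: "a \<in> carrier_vec n" "u = \<phi> (\<gamma> s) a"
      using surj[OF P[OF J(1,3)]] by metis
    then show "?L J \<gamma> t r (?L J \<gamma> s t u) = ?L J \<gamma> s r u"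
      by (simp add: frame_transport_apply[where \<phi> = \<phi> and \<gamma> = \<gamma> and s = s, OF frame[OF P[OF J(1,3)]]]
        frame_transport_apply[where \<phi> = \<phi> and \<gamma> = \<gamma> and s = t, OF frame[OF P[OF J(1,4)]]])
  next
    fix J \<gamma> s u assume J: "(J, \<gamma>) \<in> P" "s \<in> J" and "u \<in> carrier (F (\<gamma> s))"
    then obtain a where a: "a \<in> carrier_vec n" "u = \<phi> (\<gamma> s) a"
      using surj[OF P[OF J(1,2)]] by metis
    then show "?L J \<gamma> s s u = u"
      by (simp add: frame_transport_apply[where \<phi> = \<phi> and \<gamma> = \<gamma> and s = s, OF frame[OF P[OF J(1,2)]]])
  qed
qed

lemma linear_transportD:
  assumes L: "linear_transport P F L" and J: "(J, \<gamma>) \<in> P"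
  shows "s \<in> J \<Longrightarrow> t \<in> J \<Longrightarrow>
      L J \<gamma> s t \<in> LinearCombinations.module_hom class_ring (F (\<gamma> s)) (F (\<gamma> t))"
    and "r \<in> J \<Longrightarrow> s \<in> J \<Longrightarrow> t \<in> J \<Longrightarrow> u \<in> carrier (F (\<gamma> s)) \<Longrightarrow>
      L J \<gamma> t r (L J \<gamma> s t u) = L J \<gamma> s r u"
    and "s \<in> J \<Longrightarrow> u \<in> carrier (F (\<gamma> s)) \<Longrightarrow> L J \<gamma> s s u = u"
  using bspec[OF L[unfolded linear_transport_def] J] by simp_all

text \<open>The transport laws make the map from \<open>t\<close> back to \<open>s\<close> an
  inverse of the map from \<open>s\<close> to \<open>t\<close>, so a transport carries frames to
  frames. This moves a normal frame into another fibre, where inertia can compare it.\<close>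

lemma linear_frame_transport:
  assumes L: "linear_transport P F L" and J: "(J, \<gamma>) \<in> P" "s \<in> J" "t \<in> J"
    and \<phi>: "linear_frame (F (\<gamma> s)) n \<phi>"
  shows "linear_frame (F (\<gamma> t)) n (\<lambda>a. L J \<gamma> s t (\<phi> a))"
proof -
  note hom = linear_transportD(1)[OF L J(1)]
  have comp: "L J \<gamma> t' s' (L J \<gamma> s' t' u) = u" if "s' \<in> J" "t' \<in> J" "u \<in> carrier (F (\<gamma> s'))" for s' t' u
    using linear_transportD(2)[OF L J(1) that(1,1,2,3)] linear_transportD(3)[OF L J(1) that(1,3)] by simp
  have "bij_betw (L J \<gamma> s t) (carrier (F (\<gamma> s))) (carrier (F (\<gamma> t)))"
    by (rule bij_betw_byWitness[where f' = "L J \<gamma> t s"])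
      (use comp J hom[OF J(2,3), THEN module_hom_closed] hom[OF J(3,2), THEN module_hom_closed] in blast)+
  from bij_betw_trans[OF linear_frameD(1)[OF \<phi>] this]
  have bij: "bij_betw (\<lambda>a. L J \<gamma> s t (\<phi> a)) (carrier_vec n) (carrier (F (\<gamma> t)))"
    by (simp add: o_def)
  have "L J \<gamma> s t (\<phi> (a + b)) = L J \<gamma> s t (\<phi> a) \<oplus>\<^bsub>F (\<gamma> t)\<^esub> L J \<gamma> s t (\<phi> b)"
    if "a \<in> carrier_vec n" "b \<in> carrier_vec n" for a b
    using module_hom_add[OF hom[OF J(2,3)]] linear_frameD(2,3)[OF \<phi>] that by simp
  moreover have "L J \<gamma> s t (\<phi> (c \<cdot>\<^sub>v a)) = c \<odot>\<^bsub>F (\<gamma> t)\<^esub> L J \<gamma> s t (\<phi> a)"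
    if "a \<in> carrier_vec n" for a c
    using module_hom_smult[OF hom[OF J(2,3)]] linear_frameD(2,4)[OF \<phi>] that by simp
  ultimately show ?thesis
    unfolding linear_frame_def using bij by blast
qed

text \<open>Among arbitrary maps a two-valued function on the unit interval joins the points; among
  continuous ones path-connectedness supplies a path. Both are restricted to the interval, as
  membership in \<open>all_paths\<close> demands.\<close>

lemma paths_join_points:
  assumes P: "P = all_paths B \<or> P = continuous_paths B"
    and conn: "P = all_paths B \<or> path_connected_space B"
    and x: "x \<in> topspace B" and y: "y \<in> topspace B"
  obtains J \<gamma> s t where "(J, \<gamma>) \<in> P" "s \<in> J" "t \<in> J" "\<gamma> s = x" "\<gamma> t = y"
proof (cases "P = all_paths B")
  case True
  let ?\<gamma> = "restrict (\<lambda>s. if s = 0 then x else y) {0..1::real}"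
  have "({0..1}, ?\<gamma>) \<in> P"
    unfolding True all_paths_def using x y by (auto simp: is_interval_cc)
  then show ?thesis by (rule that[of _ _ 0 1]) auto
next
  case False
  with conn x y obtain c where c: "pathin B c" "c 0 = x" "c 1 = y"
    unfolding path_connected_space_def by blast
  let ?\<gamma> = "restrict c {0..1::real}"
  have cont: "continuous_map (top_of_set {0..1}) B ?\<gamma>"
    using c(1) unfolding pathin_def
    by (rule continuous_map_eq) auto
  then have "?\<gamma> \<in> {0..1} \<rightarrow>\<^sub>E topspace B"
    using continuous_map_image_subset_topspace[OF cont] by (auto simp: image_subset_iff)
  with cont have "({0..1}, ?\<gamma>) \<in> P"
    using P False unfolding continuous_paths_def all_paths_def by (auto simp: is_interval_cc)
  then show ?thesis by (rule that[of _ _ 0 1]) (use c in auto)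
qed

theorem proposition2p4:
  fixes n :: nat
    and E :: "'e topology" and B :: "'b topology" and proj :: "'e \<Rightarrow> 'b"
    and F :: "'b \<Rightarrow> (real, 'e) module"
    and g :: "'b \<Rightarrow> 'e \<Rightarrow> 'e \<Rightarrow> real"
    and P :: "(real set \<times> (real \<Rightarrow> 'b)) set"
  assumes "real_vector_bundle n E B proj F"
    and "bundle_metric B F g"
    and "P = all_paths B \<or> P = continuous_paths B"
  shows "(P = all_paths B \<or> path_connected_space B \<longrightarrow>
            (\<exists>L. linear_transport P F L \<and> globally_consistent P F g L) \<longleftrightarrow>
            constant_signature_on (topspace B) F g) \<and>
         (\<forall>(J, \<gamma>) \<in> P.
            (\<exists>L. linear_transport P F L \<and> consistent_along F g L J \<gamma>) \<longleftrightarrow>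
            constant_signature_on (\<gamma> ` J) F g)"
proof -
  let ?X = "topspace B"
  have "\<forall>x \<in> ?X. \<exists>\<phi> p. linear_frame (F x) n \<phi> \<and> p \<le> n \<and>
    (\<forall>a \<in> carrier_vec n. \<forall>b \<in> carrier_vec n. g x (\<phi> a) (\<phi> b) = signed_prod n p a b) \<and>
    (\<exists>es. ordered_basis (F x) es) \<and>
    (\<forall>es. ordered_basis (F x) es \<longrightarrow> signature (gram_matrix (g x) es) = 2 * int p - int n)"
  proof
    fix x assume "x \<in> ?X"
    then show "\<exists>\<phi> p. linear_frame (F x) n \<phi> \<and> p \<le> n \<and>
      (\<forall>a \<in> carrier_vec n. \<forall>b \<in> carrier_vec n. g x (\<phi> a) (\<phi> b) = signed_prod n p a b) \<and>
      (\<exists>es. ordered_basis (F x) es) \<and>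
      (\<forall>es. ordered_basis (F x) es \<longrightarrow> signature (gram_matrix (g x) es) = 2 * int p - int n)"
      using assms(1,2) unfolding real_vector_bundle_def bundle_metric_iff
      by (intro metric_inertia) auto
  qed
  then obtain \<phi> p where \<phi>p: "\<forall>x \<in> ?X. linear_frame (F x) n (\<phi> x) \<and> p x \<le> n \<and>
    (\<forall>a \<in> carrier_vec n. \<forall>b \<in> carrier_vec n. g x (\<phi> x a) (\<phi> x b) = signed_prod n (p x) a b) \<and>
    (\<exists>es. ordered_basis (F x) es) \<and>
    (\<forall>es. ordered_basis (F x) es \<longrightarrow> signature (gram_matrix (g x) es) = 2 * int (p x) - int n)"
    unfolding bchoice_iff by blast
  have frame: "linear_frame (F x) n (\<phi> x)" and p: "p x \<le> n"
    and basis: "\<exists>es. ordered_basis (F x) es" if "x \<in> ?X" for x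
    using \<phi>p that by blast+
  have g: "g x (\<phi> x a) (\<phi> x b) = signed_prod n (p x) a b"
    if "x \<in> ?X" "a \<in> carrier_vec n" "b \<in> carrier_vec n" for x a b
    using \<phi>p that by blast
  have sig: "signature (gram_matrix (g x) es) = 2 * int (p x) - int n"
    if "x \<in> ?X" "ordered_basis (F x) es" for x es
    using \<phi>p that by blast
  \<comment> \<open>The value \<open>2 * p x - n\<close> determines \<open>p x\<close>. That each
    fibre has an ordered basis keeps the constancy condition from being vacuous at any
    point.\<close>
  have const: "constant_signature_on S F g \<longleftrightarrow> (\<forall>x \<in> S. \<forall>y \<in> S. p x = p y)" if S: "S \<subseteq> ?X" for S
  proof
    assume "constant_signature_on S F g"
    then obtain \<sigma> where \<sigma>: "\<forall>x \<in> S. \<forall>es. ordered_basis (F x) es \<longrightarrow> signature (gram_matrix (g x) es) = \<sigma>"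
      unfolding constant_signature_on_def ..
    have *: "2 * int (p x) - int n = \<sigma>" if x: "x \<in> S" for x
    proof -
      have X: "x \<in> ?X" using S x by blast
      obtain es where es: "ordered_basis (F x) es" using basis[OF X] by blast
      show ?thesis using sig[OF X es] \<sigma> x es by metis
    qed
    show "\<forall>x \<in> S. \<forall>y \<in> S. p x = p y"
    proof (intro ballI)
      fix x y assume "x \<in> S" "y \<in> S"
      then show "p x = p y" using *[of x] *[of y] by linarith
    qed
  next
    assume eq: "\<forall>x \<in> S. \<forall>y \<in> S. p x = p y"
    \<comment> \<open>The common value is taken at some point of \<open>S\<close>; for empty
      \<open>S\<close> it is arbitrary and the claim is vacuous.\<close>
    define k where "k = p (SOME x. x \<in> S)"
    have "p x = k" if "x \<in> S" for x
      unfolding k_def using eq someI[of "\<lambda>x. x \<in> S" x] that by blast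
    then have "\<forall>x \<in> S. \<forall>es. ordered_basis (F x) es \<longrightarrow>
        signature (gram_matrix (g x) es) = 2 * int k - int n"
      using S sig by auto
    then show "constant_signature_on S F g"
      unfolding constant_signature_on_def by blast
  qed
  have PX: "\<gamma> s \<in> ?X" if "(J, \<gamma>) \<in> P" "s \<in> J" for J \<gamma> s
    using assms(3) that unfolding continuous_paths_def all_paths_def by auto
  let ?L = "frame_transport n \<phi>"
  have transport: "linear_transport P F ?L"
    by (rule linear_transport_frame_transport[where X = ?X]) (use frame PX in auto)
  \<comment> \<open>Transported vectors keep their coordinates, and in normal frames the metric
    depends on the point only through \<open>p\<close>.\<close>
  have sufficient: "consistent_along F g ?L J \<gamma>"
    if J: "(J, \<gamma>) \<in> P" and eq: "\<forall>x \<in> \<gamma> ` J. \<forall>y \<in> \<gamma> ` J. p x = p y" for J \<gamma>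
    unfolding consistent_along_def
  proof (intro ballI)
    fix s t u v assume st: "s \<in> J" "t \<in> J" and uv: "u \<in> carrier (F (\<gamma> s))" "v \<in> carrier (F (\<gamma> s))"
    note s = PX[OF J st(1)] and t = PX[OF J st(2)]
    obtain a b where ab: "a \<in> carrier_vec n" "b \<in> carrier_vec n" "u = \<phi> (\<gamma> s) a" "v = \<phi> (\<gamma> s) b"
      using linear_frame_surj[OF frame[OF s]] uv by metis
    have "p (\<gamma> s) = p (\<gamma> t)" using eq st by blast
    then show "g (\<gamma> s) u v = g (\<gamma> t) (?L J \<gamma> s t u) (?L J \<gamma> s t v)"
      using ab s t by (simp add: frame_transport_apply[where \<phi> = \<phi> and \<gamma> = \<gamma> and s = s, OF frame[OF s]] g)
  qed
  \<comment> \<open>In the fibre over \<open>\<gamma> t\<close> there are two normal frames: the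
    chosen one with \<open>p (\<gamma> t)\<close> plus signs, and the one transported from
    \<open>\<gamma> s\<close>, whose \<open>p (\<gamma> s)\<close> plus signs survive by
    consistency.\<close>
  have necessary: "p (\<gamma> s) = p (\<gamma> t)"
    if L: "linear_transport P F L" "consistent_along F g L J \<gamma>" and J: "(J, \<gamma>) \<in> P" "s \<in> J" "t \<in> J"
    for L J \<gamma> s t
  proof -
    note s = PX[OF J(1,2)] and t = PX[OF J(1,3)]
    show ?thesis
    proof (rule sylvester_inertia[where h = "g (\<gamma> t)"])
      show "linear_frame (F (\<gamma> t)) n (\<lambda>a. L J \<gamma> s t (\<phi> (\<gamma> s) a))"
        by (rule linear_frame_transport[OF L(1) J frame[OF s]])
      show "linear_frame (F (\<gamma> t)) n (\<phi> (\<gamma> t))" by (rule frame[OF t])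
      show "g (\<gamma> t) (L J \<gamma> s t (\<phi> (\<gamma> s) a)) (L J \<gamma> s t (\<phi> (\<gamma> s) a)) = signed_prod n (p (\<gamma> s)) a a"
        if a: "a \<in> carrier_vec n" for a
        using L(2) J(2,3) linear_frameD(2)[OF frame[OF s] a] g[OF s a a]
        unfolding consistent_along_def by metis
    qed (use g p s t in auto)
  qed
  have "(\<exists>L. linear_transport P F L \<and> globally_consistent P F g L) \<longleftrightarrow> constant_signature_on ?X F g"
    if conn: "P = all_paths B \<or> path_connected_space B"
  proof
    assume "\<exists>L. linear_transport P F L \<and> globally_consistent P F g L"
    then obtain L where L: "linear_transport P F L" "\<And>J \<gamma>. (J, \<gamma>) \<in> P \<Longrightarrow> consistent_along F g L J \<gamma>"
      unfolding globally_consistent_def by blast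
    have "p x = p y" if x: "x \<in> ?X" and y: "y \<in> ?X" for x y
    proof -
      \<comment> \<open>Consistency compares \<open>p\<close> only at points of one path, so two
        arbitrary points of the base are first placed on a common path.\<close>
      obtain J \<gamma> s t where J: "(J, \<gamma>) \<in> P" "s \<in> J" "t \<in> J" and xy: "\<gamma> s = x" "\<gamma> t = y"
        using paths_join_points[OF assms(3) conn x y] .
      show ?thesis using necessary[OF L(1) L(2)[OF J(1)] J] xy by simp
    qed
    then show "constant_signature_on ?X F g" unfolding const[OF subset_refl] by blast
  next
    assume "constant_signature_on ?X F g"
    then have "\<forall>x \<in> ?X. \<forall>y \<in> ?X. p x = p y" unfolding const[OF subset_refl] .
    then have "consistent_along F g ?L J \<gamma>" if J: "(J, \<gamma>) \<in> P" for J \<gamma>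
      using PX[OF J] by (intro sufficient[OF J]) blast
    with transport show "\<exists>L. linear_transport P F L \<and> globally_consistent P F g L"
      unfolding globally_consistent_def by blast
  qed
  moreover have "(\<exists>L. linear_transport P F L \<and> consistent_along F g L J \<gamma>) \<longleftrightarrow>
      constant_signature_on (\<gamma> ` J) F g" if J: "(J, \<gamma>) \<in> P" for J \<gamma>
  proof -
    have "\<gamma> ` J \<subseteq> ?X" using PX[OF J] by blast
    from const[OF this] show ?thesis
    proof (elim ssubst, intro iffI)
      assume "\<exists>L. linear_transport P F L \<and> consistent_along F g L J \<gamma>"
      then show "\<forall>x \<in> \<gamma> ` J. \<forall>y \<in> \<gamma> ` J. p x = p y"
        using necessary[OF _ _ J] by blast
    next
      assume "\<forall>x \<in> \<gamma> ` J. \<forall>y \<in> \<gamma> ` J. p x = p y"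
      \<comment> \<open>The frame transport is defined along every path of \<open>P\<close>, while
        its consistency is claimed only along \<open>\<gamma>\<close>, where \<open>p\<close> is
        constant.\<close>
      from sufficient[OF J this] show "\<exists>L. linear_transport P F L \<and> consistent_along F g L J \<gamma>"
        using transport by blast
    qed
  qed
  ultimately show ?thesis by blast
qed

end
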